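(* Let $B,M>0$. Let $u:\Omega\to\mathbb{R}$ be a convex function and let $x^*\in\arg\min_{x:\|x\|\le B}u(x)$. Let $\epsilon>0$ be given. Assume that $\epsilon$-stochastic subgradient descent ($\epsilon$-SGD) is run for $K$ iterations with $\alpha=\sqrt{\frac{B^2}{M^2K}}$. Assume also that for all $k$ we have $\|g^k\|\le M$ with probability $1$. Then the output vector $\bar x$ satisfies $$\mathbb{E}[u(\bar x)]-u(x^* )\le\frac{BM}{\sqrt K}+\epsilon .$$ Thus, for every $\hat\epsilon>\epsilon$, running $\epsilon$-SGD for $K$ iterations with $K\ge\frac{B^2M^2}{(\hat\epsilon-\epsilon)^2}$ ensures that $\mathbb{E}[u(\bar x)]-u(x^* )\le\hat\epsilon$.
   Context: $\Omega\subset\mathbb{R}^D$ is a bounded, connected, simply connected open set with smooth compact boundary, and $\|\cdot\|$ is the Euclidean norm. For $\epsilon>0$, a vector $z\in\mathbb{R}^D$ is an $\epsilon$-subgradient of $u$ at $x$ if $u(y)-u(x)\ge (y-x)^Tz-\epsilon$ for all $y\in\Omega$. The set of all $\epsilon$-subgradients of $u$ at $x$ is called the $\epsilon$-subdifferential set of $u$ at $x$ and is denoted $\partial_\epsilon u(x)$. $\epsilon$-SGD with scalar inputs $\alpha,\epsilon>0$ and an integer $K>0$ is the following procedure: initialize $x^1=0$; for $k=1,\ldots,K$, choose $g^k$ at random from a distribution such that $\mathbb{E}[g^k\mid x^k]\in\partial_\epsilon u(x^k)$, and set $x^{k+1}=x^k-\alpha g^k$; output $\bar x=\frac1K\sum_{k=1}^K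 x^k$. *)

theory Defs
  imports "HOL-Probability.Probability"
begin

fun diff_upto :: "nat \<Rightarrow> 'a::real_normed_vector set \<Rightarrow> ('a \<Rightarrow> real) \<Rightarrow> bool" where
  "diff_upto 0 U f \<longleftrightarrow> continuous_on U f"
| "diff_upto (Suc n) U f \<longleftrightarrow>
     (\<forall>x\<in>U. f differentiable (at x)) \<and>
     (\<forall>v. diff_upto n U (\<lambda>x. frechet_derivative f (at x) v))"

definition smooth_fun_on :: "'a::real_normed_vector set \<Rightarrow> ('a \<Rightarrow> real) \<Rightarrow> bool" where
  "smooth_fun_on U f \<longleftrightarrow> (\<forall>n. diff_upto n U f)"

text \<open>
  The boundary is smooth if near each of its points it is the regular zero level set of a smooth
  function whose negative set is the domain (so the domain lies locally on one side).
\<close>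

definition smooth_boundary :: "(real^'d) set \<Rightarrow> bool" where
  "smooth_boundary \<Omega> \<longleftrightarrow>
     (\<forall>p\<in>frontier \<Omega>. \<exists>U \<phi>. open U \<and> p \<in> U \<and> smooth_fun_on U \<phi> \<and>
        (\<forall>x\<in>U. (x \<in> \<Omega> \<longleftrightarrow> \<phi> x < 0) \<and> (x \<in> frontier \<Omega> \<longleftrightarrow> \<phi> x = 0) \<and>
               frechet_derivative \<phi> (at x) \<noteq> (\<lambda>v. 0)))"

text \<open>
  The function \<^term>\<open>u\<close> is meaningful on \<^term>\<open>\<Omega>\<close> only, so there are no subgradients at points
  outside \<^term>\<open>\<Omega>\<close>.
\<close>

definition eps_subdifferential ::
    "real \<Rightarrow> (real^'d) set \<Rightarrow> (real^'d \<Rightarrow> real) \<Rightarrow> real^'d \<Rightarrow> (real^'d) set" where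
  "eps_subdifferential \<epsilon> \<Omega> u x =
     {z. x \<in> \<Omega> \<and> (\<forall>y\<in>\<Omega>. u y - u x \<ge> (y - x) \<bullet> z - \<epsilon>)}"

text \<open>
  The conditional expectation of a random vector \<^term>\<open>g\<close> given a random vector \<^term>\<open>X\<close>, i.e.
  given the sigma-algebra generated by \<^term>\<open>X\<close>. It is taken componentwise.
\<close>

definition vec_cond_exp ::
    "'w measure \<Rightarrow> ('w \<Rightarrow> real^'d) \<Rightarrow> ('w \<Rightarrow> real^'d) \<Rightarrow> 'w \<Rightarrow> real^'d" where
  "vec_cond_exp P X g \<omega> =
     (\<chi> i. real_cond_exp P (vimage_algebra (space P) X borel) (\<lambda>\<omega>'. g \<omega>' $ i) \<omega>)"

text \<open>
  The processes \<^term>\<open>x\<close> and \<^term>\<open>g\<close> on the probability space \<^term>\<open>P\<close> are the iterates and the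
  stochastic subgradients of a run of the method. Indices start at 1, and \<^term>\<open>x 0\<close> and
  \<^term>\<open>g 0\<close> are irrelevant. Since conditional expectations are determined only almost surely, the
  subdifferential condition is required almost surely.
\<close>

definition eps_SGD_run ::
    "'w measure \<Rightarrow> (real^'d) set \<Rightarrow> (real^'d \<Rightarrow> real) \<Rightarrow> real \<Rightarrow> real \<Rightarrow> nat \<Rightarrow>
     (nat \<Rightarrow> 'w \<Rightarrow> real^'d) \<Rightarrow> (nat \<Rightarrow> 'w \<Rightarrow> real^'d) \<Rightarrow> bool" where
  "eps_SGD_run P \<Omega> u \<alpha> \<epsilon> K x g \<longleftrightarrow>
     (\<forall>\<omega>\<in>space P. x 1 \<omega> = 0) \<and>
     (\<forall>k\<in>{1..K}.
        integrable P (g k) \<and>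
        (AE \<omega> in P. vec_cond_exp P (x k) (g k) \<omega> \<in> eps_subdifferential \<epsilon> \<Omega> u (x k \<omega>)) \<and>
        (\<forall>\<omega>\<in>space P. x (Suc k) \<omega> = x k \<omega> - \<alpha> *\<^sub>R g k \<omega>))"

definition SGD_output :: "nat \<Rightarrow> (nat \<Rightarrow> 'w \<Rightarrow> real^'d) \<Rightarrow> 'w \<Rightarrow> real^'d" where
  "SGD_output K x \<omega> = (1 / real K) *\<^sub>R (\<Sum>k=1..K. x k \<omega>)"

end

theory Submission
  imports Defs
begin

text \<open>
  The distances to a minimiser \<open>p\<close> telescope along the iteration, which bounds the regret
  \<open>\<Sum>k. (x k - p) \<bullet> g k\<close> surely. By the pull-out property of conditional expectations, this regret has
  the same expectation as the sum of the \<open>(x k - p) \<bullet> E[g k | x k]\<close>, and those dominate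
  \<open>u (x k) - u p - \<epsilon>\<close> almost surely by the subgradient inequality. Jensen's inequality transfers the
  bound to the average. The subgradient inequality at the first iterate bounds \<open>u\<close> from
  below on the bounded set \<open>\<Omega>\<close>, so that the value at the output is integrable although \<open>u\<close> may be
  unbounded near the boundary.
\<close>

text \<open>Expanding the squared distance to \<open>p\<close> after one step gives the old squared
  distance, the cross term \<open>- 2 * \<alpha> * ((y k - p) \<bullet> g k)\<close> and a remainder
  of at most \<open>\<alpha>\<^sup>2 * M\<^sup>2\<close>. The last squared distance stays on the
  left, since the induction step expands the next one from it.\<close>

lemma gradient_step_regret_aux:
  fixes y g :: "nat \<Rightarrow> 'a::real_inner"
  assumes step: "\<And>k. k \<in> {1..K} \<Longrightarrow> y (Suc k) = y k - \<alpha> *\<^sub>R g k"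
    and g: "\<And>k. k \<in> {1..K} \<Longrightarrow> norm (g k) \<le> M"
  shows "2 * \<alpha> * (\<Sum>k=1..K. (y k - p) \<bullet> g k) + (norm (y (Suc K) - p))\<^sup>2
    \<le> (norm (y 1 - p))\<^sup>2 + \<alpha>\<^sup>2 * M\<^sup>2 * real K"
  using assms
proof (induction K)
  case 0
  then show ?case by simp
next
  case (Suc K)
  let ?d = "y (Suc K) - p" and ?g = "g (Suc K)"
  have IH: "2 * \<alpha> * (\<Sum>k=1..K. (y k - p) \<bullet> g k) + (norm ?d)\<^sup>2
    \<le> (norm (y 1 - p))\<^sup>2 + \<alpha>\<^sup>2 * M\<^sup>2 * real K"
    by (rule Suc.IH) (use Suc.prems in auto)
  have "(norm ?g)\<^sup>2 \<le> M\<^sup>2"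
    using Suc.prems(2)[of "Suc K"] by (intro power_mono) auto
  then have le: "\<alpha>\<^sup>2 * (norm ?g)\<^sup>2 \<le> \<alpha>\<^sup>2 * M\<^sup>2"
    by (intro mult_left_mono) auto
  have "y (Suc (Suc K)) - p = ?d - \<alpha> *\<^sub>R ?g"
    using Suc.prems(1)[of "Suc K"] by (simp add: algebra_simps)
  then have "(norm (y (Suc (Suc K)) - p))\<^sup>2
      = (norm ?d)\<^sup>2 - 2 * \<alpha> * (?d \<bullet> ?g) + \<alpha>\<^sup>2 * (norm ?g)\<^sup>2"
    by (simp only: power2_norm_eq_inner)
       (simp add: inner_diff_left inner_diff_right inner_commute power2_eq_square algebra_simps)
  with IH le show ?case by (simp add: algebra_simps)
qed

text \<open>Follows by dropping the last squared distance and dividing by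
  \<open>2 * \<alpha>\<close>. The two remaining terms pull \<alpha> in opposite directions, which
  explains the step size chosen later.\<close>

lemma gradient_step_regret:
  fixes y g :: "nat \<Rightarrow> 'a::real_inner"
  assumes "\<alpha> > 0"
    and "\<And>k. k \<in> {1..K} \<Longrightarrow> y (Suc k) = y k - \<alpha> *\<^sub>R g k"
    and "\<And>k. k \<in> {1..K} \<Longrightarrow> norm (g k) \<le> M"
    and "norm (y 1 - p) \<le> B"
  shows "(\<Sum>k=1..K. (y k - p) \<bullet> g k) \<le> (B\<^sup>2 / \<alpha> + \<alpha> * M\<^sup>2 * real K) / 2"
proof -
  have "(norm (y 1 - p))\<^sup>2 \<le> B\<^sup>2"
    using assms(4) by (intro power_mono) auto
  moreover have "0 \<le> (norm (y (Suc K) - p))\<^sup>2" by simp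
  ultimately have "2 * \<alpha> * (\<Sum>k=1..K. (y k - p) \<bullet> g k) \<le> B\<^sup>2 + \<alpha>\<^sup>2 * M\<^sup>2 * real K"
    using gradient_step_regret_aux[where K = K and y = y and g = g and p = p, OF assms(2,3)] by linarith
  then show ?thesis
    using assms(1) by (simp add: field_simps power2_eq_square)
qed

text \<open>This is the pull-out property for an inner product: each component of
  \<open>f (X \<omega>)\<close> is measurable for the sigma-algebra generated by \<open>X\<close>,
  so the scalar property applies coordinate by coordinate. The bound is asked only almost surely
  because iterates are known to lie in the bounded domain only almost surely.\<close>

lemma vec_cond_exp_inner:
  fixes X g :: "'w \<Rightarrow> real^'d" and f :: "real^'d \<Rightarrow> real^'d"
  assumes P: "prob_space P" and X: "X \<in> borel_measurable P"
    and f: "f \<in> borel_measurable borel" and g: "integrable P g"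
    and bd: "AE \<omega> in P. norm (f (X \<omega>)) \<le> c"
  shows "integrable P (\<lambda>\<omega>. f (X \<omega>) \<bullet> g \<omega>)"
    and "integrable P (\<lambda>\<omega>. f (X \<omega>) \<bullet> vec_cond_exp P X g \<omega>)"
    and "(\<integral>\<omega>. f (X \<omega>) \<bullet> vec_cond_exp P X g \<omega> \<partial>P) = (\<integral>\<omega>. f (X \<omega>) \<bullet> g \<omega> \<partial>P)"
proof -
  let ?F = "vimage_algebra (space P) X borel"
  interpret prob_space P by (rule P)
  have sub: "subalgebra P ?F"
    using X by (auto simp: subalgebra_def sets_vimage_algebra2 measurable_def)
  interpret finite_measure_subalgebra P ?F
    by unfold_locales (rule sub)
  have XF: "X \<in> borel_measurable ?F"
    by (rule measurable_vimage_algebra1) auto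
  have fXF: "(\<lambda>\<omega>. f (X \<omega>) $ i) \<in> borel_measurable ?F" for i
    using measurable_compose[OF measurable_compose[OF XF f]
        borel_measurable_continuous_onI[OF continuous_on_component[OF continuous_on_id]]] .
  have fXP: "(\<lambda>\<omega>. f (X \<omega>) $ i) \<in> borel_measurable P" for i
    using fXF sub measurable_from_subalg by blast
  have gi: "integrable P (\<lambda>\<omega>. g \<omega> $ i)" for i
    using g by (rule integrable_bounded_linear[OF bounded_linear_vec_nth])
  then have gm: "(\<lambda>\<omega>. g \<omega> $ i) \<in> borel_measurable P" for i by auto
  have fg: "integrable P (\<lambda>\<omega>. f (X \<omega>) $ i * g \<omega> $ i)" for i
  \<comment> \<open>A component is at most the norm in absolute value, so a multiple of the
    integrable \<open>g \<omega> $ i\<close> dominates the product.\<close>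
  proof (rule Bochner_Integration.integrable_bound[where f = "\<lambda>\<omega>. c * g \<omega> $ i"])
    show "AE \<omega> in P. norm (f (X \<omega>) $ i * g \<omega> $ i) \<le> norm (c * g \<omega> $ i)"
      using bd
    proof eventually_elim
      case (elim \<omega>)
      have "\<bar>f (X \<omega>) $ i\<bar> \<le> \<bar>c\<bar>"
        using elim component_le_norm_cart[of "f (X \<omega>)" i] by linarith
      then show ?case by (simp add: abs_mult mult_right_mono)
    qed
  qed (use fXP gm gi in auto)
  show "integrable P (\<lambda>\<omega>. f (X \<omega>) \<bullet> g \<omega>)"
    using fg by (simp add: inner_vec_def)
  show "integrable P (\<lambda>\<omega>. f (X \<omega>) \<bullet> vec_cond_exp P X g \<omega>)"
    using real_cond_exp_intg(1)[OF fg fXF gm] by (simp add: inner_vec_def vec_cond_exp_def)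
  show "(\<integral>\<omega>. f (X \<omega>) \<bullet> vec_cond_exp P X g \<omega> \<partial>P) = (\<integral>\<omega>. f (X \<omega>) \<bullet> g \<omega> \<partial>P)"
    using real_cond_exp_intg[OF fg fXF gm] fg
    by (simp add: inner_vec_def vec_cond_exp_def)
qed

text \<open>Convexity gives continuity on the open set \<open>S\<close>, and extensionality makes
  \<open>u\<close> constant off \<open>S\<close>. Measurability on the whole space matters because
  the output may leave the domain on a null set.\<close>

lemma convex_on_extensional_borel_measurable:
  fixes u :: "'a::euclidean_space \<Rightarrow> real"
  assumes "open S" and "convex_on S u" and "u \<in> S \<rightarrow>\<^sub>E UNIV"
  shows "u \<in> borel_measurable borel"
proof -
  have "(\<lambda>y. if y \<in> S then u y else undefined) \<in> borel_measurable borel"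
    using assms convex_on_continuous[OF assms(1,2)] by (intro borel_measurable_continuous_on_if) auto
  moreover have "(\<lambda>y. if y \<in> S then u y else undefined) = u"
    using assms(3) by (auto simp: PiE_def extensional_def)
  ultimately show ?thesis by simp
qed

lemma convex_on_uniform_average:
  fixes u :: "'a::real_vector \<Rightarrow> real"
  assumes "convex_on S u" and "K > 0" and "\<And>k. k \<in> {1..K} \<Longrightarrow> y k \<in> S"
  shows "(1 / real K) *\<^sub>R (\<Sum>k=1..K. y k) \<in> S"
    and "u ((1 / real K) *\<^sub>R (\<Sum>k=1..K. y k)) \<le> (\<Sum>k=1..K. u (y k)) / real K"
proof -
  have "convex S"
    using assms(1) by (rule convex_on_imp_convex)
  then have "(\<Sum>k=1..K. (1 / real K) *\<^sub>R y k) \<in> S"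
    using assms(2,3) by (intro convex_sum) auto
  then show "(1 / real K) *\<^sub>R (\<Sum>k=1..K. y k) \<in> S"
    by (simp add: scaleR_sum_right)
  have "u (\<Sum>k=1..K. (1 / real K) *\<^sub>R y k) \<le> (\<Sum>k=1..K. 1 / real K * u (y k))"
    using assms by (intro convex_on_sum[OF _ _ assms(1)]) auto
  then show "u ((1 / real K) *\<^sub>R (\<Sum>k=1..K. y k)) \<le> (\<Sum>k=1..K. u (y k)) / real K"
    by (simp add: scaleR_sum_right sum_divide_distrib)
qed

theorem theorem2p9:
  fixes \<Omega> :: "(real^'d) set" and u :: "real^'d \<Rightarrow> real" and xstar :: "real^'d"
    and P :: "'w measure" and x g :: "nat \<Rightarrow> 'w \<Rightarrow> real^'d"
    and B M \<epsilon> \<alpha> :: real and K :: nat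
  assumes "open \<Omega>" and "bounded \<Omega>" and "connected \<Omega>" and "simply_connected \<Omega>"
    and "compact (frontier \<Omega>)" and "smooth_boundary \<Omega>"
    and "B > 0" and "M > 0"
    and "u \<in> \<Omega> \<rightarrow>\<^sub>E UNIV" and "convex_on \<Omega> u"
    and "is_arg_min u (\<lambda>y. y \<in> \<Omega> \<and> norm y \<le> B) xstar"
    and "\<epsilon> > 0" and "K > 0"
    and "\<alpha> = sqrt (B\<^sup>2 / (M\<^sup>2 * real K))"
    and "prob_space P"
    and "eps_SGD_run P \<Omega> u \<alpha> \<epsilon> K x g"
    and "\<And>k. k \<in> {1..K} \<Longrightarrow> AE \<omega> in P. norm (g k \<omega>) \<le> M"
  shows "integrable P (\<lambda>\<omega>. u (SGD_output K x \<omega>)) \<and>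
     prob_space.expectation P (\<lambda>\<omega>. u (SGD_output K x \<omega>)) - u xstar \<le> B * M / sqrt (real K) + \<epsilon> \<and>
     (\<forall>\<epsilon>'>\<epsilon>. real K \<ge> B\<^sup>2 * M\<^sup>2 / (\<epsilon>' - \<epsilon>)\<^sup>2 \<longrightarrow>
        prob_space.expectation P (\<lambda>\<omega>. u (SGD_output K x \<omega>)) - u xstar \<le> \<epsilon>')"
proof -
  interpret prob_space P by (rule assms(15))
  from assms(16) have x1: "\<And>\<omega>. \<omega> \<in> space P \<Longrightarrow> x 1 \<omega> = 0"
    and gint: "\<And>k. k \<in> {1..K} \<Longrightarrow> integrable P (g k)"
    and sub: "\<And>k. k \<in> {1..K} \<Longrightarrow>
        AE \<omega> in P. vec_cond_exp P (x k) (g k) \<omega> \<in> eps_subdifferential \<epsilon> \<Omega> u (x k \<omega>)"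
    and step_eq: "\<And>k \<omega>. k \<in> {1..K} \<Longrightarrow> \<omega> \<in> space P \<Longrightarrow> x (Suc k) \<omega> = x k \<omega> - \<alpha> *\<^sub>R g k \<omega>"
    by (auto simp: eps_SGD_run_def)
  have p: "xstar \<in> \<Omega>" "norm xstar \<le> B"
    using assms(11) by (auto simp: is_arg_min_def)
  obtain C where C: "\<And>y. y \<in> \<Omega> \<Longrightarrow> norm y \<le> C"
    using assms(2) by (auto simp: bounded_iff)
  let ?z = "\<lambda>k. vec_cond_exp P (x k) (g k)" and ?out = "SGD_output K x"

  \<comment> \<open>Measurability of the iterates is inherited from the integrable
    \<open>g k\<close> through the recursion. The induction starts at 1, as nothing is known about
    \<open>x 0\<close>.\<close>
  have xmeas: "x k \<in> borel_measurable P" if "1 \<le> k" "k \<le> K" for k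
    using that
  proof (induction k rule: dec_induct)
    case base
    have "x 1 \<in> borel_measurable P \<longleftrightarrow> (\<lambda>_. 0 :: real^'d) \<in> borel_measurable P"
      using x1 by (intro measurable_cong) auto
    then show ?case by simp
  next
    case (step k)
    then have k: "k \<in> {1..K}" by auto
    have "x (Suc k) \<in> borel_measurable P \<longleftrightarrow>
        (\<lambda>\<omega>. x k \<omega> - \<alpha> *\<^sub>R g k \<omega>) \<in> borel_measurable P"
      using step_eq k
      by (intro measurable_cong) auto
    moreover have "x k \<in> borel_measurable P" "g k \<in> borel_measurable P"
      using step k gint by auto
    ultimately show ?case by simp
  qed
  have outmeas: "?out \<in> borel_measurable P"
    unfolding SGD_output_def using xmeas by (auto intro!: borel_measurable_sum borel_measurable_scaleR)
  have umeas: "(\<lambda>\<omega>. u (?out \<omega>)) \<in> borel_measurable P"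
    using outmeas convex_on_extensional_borel_measurable[OF assms(1,10,9)] by measurable

  have AEsub: "AE \<omega> in P. \<forall>k\<in>{1..K}. ?z k \<omega> \<in> eps_subdifferential \<epsilon> \<Omega> u (x k \<omega>)"
    using sub by (intro AE_finite_allI) auto
  have AEg: "AE \<omega> in P. \<forall>k\<in>{1..K}. norm (g k \<omega>) \<le> M"
    using assms(17) by (intro AE_finite_allI) auto

  \<comment> \<open>The update has no projection; what keeps the iterates in \<open>\<Omega>\<close>
    is that the \<epsilon>-subdifferential is empty outside it.\<close>
  have dist: "AE \<omega> in P. norm (x k \<omega> - xstar) \<le> C + B" if "k \<in> {1..K}" for k
    using sub[OF that]
  proof eventually_elim
    case (elim \<omega>)
    then have "x k \<omega> \<in> \<Omega>" by (simp add: eps_subdifferential_def)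
    with C p(2) show ?case
      by (meson add_mono norm_triangle_ineq4 order_trans)
  qed
  note pull_out = vec_cond_exp_inner[OF prob_space_axioms xmeas _ gint dist]
  have ints: "integrable P (\<lambda>\<omega>. (x k \<omega> - xstar) \<bullet> g k \<omega>)"
      "integrable P (\<lambda>\<omega>. (x k \<omega> - xstar) \<bullet> ?z k \<omega>)"
      "(\<integral>\<omega>. (x k \<omega> - xstar) \<bullet> ?z k \<omega> \<partial>P) = (\<integral>\<omega>. (x k \<omega> - xstar) \<bullet> g k \<omega> \<partial>P)"
    if "k \<in> {1..K}" for k
    using pull_out[of k] that by auto

  \<comment> \<open>An integrable majorant of \<open>u (?out \<omega>)\<close>, built from inner
    products only, so no expectation of a single \<open>u (x k \<omega>)\<close> is ever
    taken.\<close>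
  define h where "h \<omega> = (\<Sum>k=1..K. (x k \<omega> - xstar) \<bullet> ?z k \<omega>) / real K + (\<epsilon> + u xstar)" for \<omega>
  have hint: "integrable P h"
    unfolding h_def using ints(2)
    by (intro Bochner_Integration.integrable_add Bochner_Integration.integrable_divide
        Bochner_Integration.integrable_sum) auto

  have upper: "AE \<omega> in P. u (?out \<omega>) \<le> h \<omega>"
    using AEsub
  proof eventually_elim
    case (elim \<omega>)
    \<comment> \<open>The subgradient inequality at \<open>x k \<omega>\<close> is tested at the
      point \<open>xstar\<close>.\<close>
    have u: "u (x k \<omega>) \<le> (x k \<omega> - xstar) \<bullet> ?z k \<omega> + (\<epsilon> + u xstar)" if "k \<in> {1..K}" for k
    proof -
      have "(xstar - x k \<omega>) \<bullet> ?z k \<omega> - \<epsilon> \<le> u xstar - u (x k \<omega>)"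
        using elim that p(1) by (auto simp: eps_subdifferential_def)
      then show ?thesis by (simp add: inner_diff_left)
    qed
    have "u (?out \<omega>) \<le> (\<Sum>k=1..K. u (x k \<omega>)) / real K"
      unfolding SGD_output_def using elim
      by (intro convex_on_uniform_average[OF assms(10,13)]) (auto simp: eps_subdifferential_def)
    also have "\<dots> \<le> (\<Sum>k=1..K. (x k \<omega> - xstar) \<bullet> ?z k \<omega> + (\<epsilon> + u xstar)) / real K"
      by (intro divide_right_mono sum_mono u) auto
    also have "\<dots> = h \<omega>"
      using assms(13) by (simp add: h_def sum.distrib field_simps)
    finally show ?case .
  qed

  obtain c where c: "\<And>y. y \<in> \<Omega> \<Longrightarrow> c \<le> u y"
  proof -
    \<comment> \<open>The statement under \<open>AE\<close> does not depend on
      \<open>\<omega>\<close>, so on a probability space it holds outright. This yields one fixed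
      \<epsilon>-subgradient, whose affine minorant is bounded below on the bounded domain.\<close>
    have "AE \<omega> in P. \<exists>v z. z \<in> eps_subdifferential \<epsilon> \<Omega> u v"
      by (rule eventually_mono[OF sub[of 1]]) (use assms(13) in auto)
    then have "\<exists>v z. z \<in> eps_subdifferential \<epsilon> \<Omega> u v"
      by (simp only: AE_const)
    then obtain v z where z: "z \<in> eps_subdifferential \<epsilon> \<Omega> u v" by blast
    show thesis
    proof (rule that)
      fix y assume y: "y \<in> \<Omega>"
      then have "(y - v) \<bullet> z - \<epsilon> \<le> u y - u v"
        using z by (auto simp: eps_subdifferential_def)
      moreover have "- (C * norm z) \<le> y \<bullet> z"
        using Cauchy_Schwarz_ineq2[of y z] mult_right_mono[OF C[OF y], of "norm z"] by fastforce
      ultimately show "u v - v \<bullet> z - \<epsilon> - C * norm z \<le> u y"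
        by (simp add: inner_diff_left)
    qed
  qed
  have lower: "AE \<omega> in P. c \<le> u (?out \<omega>)"
    using AEsub
  proof eventually_elim
    case (elim \<omega>)
    have "?out \<omega> \<in> \<Omega>"
      unfolding SGD_output_def using elim
      by (intro convex_on_uniform_average[OF assms(10,13)]) (auto simp: eps_subdifferential_def)
    then show ?case by (rule c)
  qed

  have uint: "integrable P (\<lambda>\<omega>. u (?out \<omega>))"
  \<comment> \<open>A value between \<open>c\<close> and \<open>h \<omega>\<close> is at most
    \<open>\<bar>c\<bar> + \<bar>h \<omega>\<bar>\<close> in absolute value.\<close>
  proof (rule Bochner_Integration.integrable_bound[where f = "\<lambda>\<omega>. \<bar>c\<bar> + \<bar>h \<omega>\<bar>"])
    show "AE \<omega> in P. norm (u (?out \<omega>)) \<le> norm (\<bar>c\<bar> + \<bar>h \<omega>\<bar>)"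
      using upper lower by eventually_elim auto
  qed (use hint umeas in auto)

  have \<alpha>: "\<alpha> = B / (M * sqrt (real K))"
    using assms(7,8,14) by (simp add: real_sqrt_divide real_sqrt_mult)
  then have "\<alpha> > 0"
    using assms(7,8,13) by simp
  have regret: "AE \<omega> in P. (\<Sum>k=1..K. (x k \<omega> - xstar) \<bullet> g k \<omega>) \<le> B * M * sqrt (real K)"
    using AEg AE_space
  proof eventually_elim
    case (elim \<omega>)
    have "(\<Sum>k=1..K. (x k \<omega> - xstar) \<bullet> g k \<omega>) \<le> (B\<^sup>2 / \<alpha> + \<alpha> * M\<^sup>2 * real K) / 2"
      using elim step_eq p(2) x1 \<open>\<alpha> > 0\<close>
      by (intro gradient_step_regret[where y = "\<lambda>k. x k \<omega>"]) auto
    \<comment> \<open>The given \<alpha> balances the bound: \<open>B\<^sup>2 / \<alpha>\<close> and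
      \<open>\<alpha> * M\<^sup>2 * real K\<close> both equal
      \<open>B * M * sqrt (real K)\<close>.\<close>
    also have "\<dots> = B * M * sqrt (real K)"
    proof -
      have K: "real K = sqrt (real K) * sqrt (real K)" by simp
      have "B\<^sup>2 / \<alpha> = B * M * sqrt (real K)"
        using assms(7) by (simp add: \<alpha> power2_eq_square)
      moreover have "\<alpha> * M\<^sup>2 * real K = B * M * sqrt (real K)"
        using assms(8,13) by (subst K) (simp add: \<alpha> power2_eq_square del: real_sqrt_mult_self)
      ultimately show ?thesis by simp
    qed
    finally show ?case .
  qed
  \<comment> \<open>The regret bound is pathwise for the sampled \<open>g k\<close>; only in
    expectation may these be exchanged for their conditional means.\<close>
  have "(\<integral>\<omega>. (\<Sum>k=1..K. (x k \<omega> - xstar) \<bullet> ?z k \<omega>) \<partial>P)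
      = (\<integral>\<omega>. (\<Sum>k=1..K. (x k \<omega> - xstar) \<bullet> g k \<omega>) \<partial>P)"
    using ints by (simp add: Bochner_Integration.integral_sum)
  also have "\<dots> \<le> B * M * sqrt (real K)"
    using regret ints(1) by (intro integral_le_const) auto
  finally have regret_exp: "(\<integral>\<omega>. (\<Sum>k=1..K. (x k \<omega> - xstar) \<bullet> ?z k \<omega>) \<partial>P) \<le> B * M * sqrt (real K)" .
  have "expectation (\<lambda>\<omega>. u (?out \<omega>)) \<le> expectation h"
    using uint hint upper by (rule integral_mono_AE)
  also have "\<dots> = (\<integral>\<omega>. (\<Sum>k=1..K. (x k \<omega> - xstar) \<bullet> ?z k \<omega>) \<partial>P) / real K + (\<epsilon> + u xstar)"
    unfolding h_def using ints(2)
    by (subst Bochner_Integration.integral_add)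
       (auto simp: prob_space intro!: Bochner_Integration.integrable_divide
          Bochner_Integration.integrable_sum)
  also have "\<dots> \<le> B * M * sqrt (real K) / real K + (\<epsilon> + u xstar)"
    using regret_exp by (intro add_right_mono divide_right_mono) auto
  also have "B * M * sqrt (real K) / real K = B * M / sqrt (real K)"
    using assms(13) by (simp add: field_simps)
  finally have bound: "expectation (\<lambda>\<omega>. u (?out \<omega>)) - u xstar \<le> B * M / sqrt (real K) + \<epsilon>"
    by simp
  have "expectation (\<lambda>\<omega>. u (?out \<omega>)) - u xstar \<le> \<epsilon>'"
    if "\<epsilon>' > \<epsilon>" and "real K \<ge> B\<^sup>2 * M\<^sup>2 / (\<epsilon>' - \<epsilon>)\<^sup>2" for \<epsilon>'
  proof -
    \<comment> \<open>The condition on \<open>K\<close> says exactly that the error term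
      \<open>B * M / sqrt (real K)\<close> fits into the gap
      \<open>\<epsilon>' - \<epsilon>\<close>, once square roots are taken.\<close>
    have "(B * M / (\<epsilon>' - \<epsilon>))\<^sup>2 \<le> real K"
      using that(2) by (simp add: power_divide power_mult_distrib)
    then have "B * M / (\<epsilon>' - \<epsilon>) \<le> sqrt (real K)"
      by (rule real_le_rsqrt)
    then have "B * M / sqrt (real K) \<le> \<epsilon>' - \<epsilon>"
      using that(1) assms(13) by (simp add: field_simps)
    with bound show ?thesis by simp
  qed
  with uint bound show ?thesis by blast
qed

end
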